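(* Let $d\ge1$, $\alpha\in(0,2)$, let $V:\mathbb{R}^d\to\mathbb{R}$ be a locally bounded Borel measurable function with $e^{-V}\in L^1(dx)$, and let $\mu_V$ and $\mathscr{D}_{\alpha,V}$ be as defined in the context. (1) If $$\liminf_{|x|\to\infty}\frac{e^{V(x)}}{|x|^{d+\alpha}}>0,$$ then there is a constant $C_1>0$ such that the weighted Poincaré inequality $$\int f^2(x)\,\frac{e^{V(x)}}{1+|x|^{d+\alpha}}\,\mu_V(dx)\le C_1\,\mathscr{D}_{\alpha,V}(f,f)$$ holds for all $f\in C_b^\infty(\mathbb{R}^d)$ with $\mu_V(f)=0$. In particular, there is a constant $C_2>0$ such that the Poincaré inequality $$\mu_V(f^2)\le C_2\,\mathscr{D}_{\alpha,V}(f,f)$$ holds for all $f\in C_b^\infty(\mathbb{R}^d)$ with $\mu_V(f)=0$. (2) For any such locally bounded function $V$ (without the growth condition in (1)), there is no function $\beta:(0,\infty)\to(0,\infty)$ such that the super Poincaré inequality $$\mu_V(f^2)\le s\,\mathscr{D}_{\alpha,V}(f,f)+\beta(s)\,\mu_V(|f|)^2,\qquad s>0,\ f\in C_b^\infty(\mathbb{R}^d),$$ holds.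
   Context: $C_b^\infty(\mathbb{R}^d)$ is the set of smooth functions with bounded derivatives of every order (including order $0$). $\mu_V(dx)=C_Ve^{-V(x)}\,dx$ with $C_V=\big(\int e^{-V(x)}dx\big)^{-1}$ is a probability measure, and $\mu_V(g):=\int g\,d\mu_V$. The form is $$\mathscr{D}_{\alpha,V}(f,f):=\frac12\iint_{\{|x-y|>1\}}\frac{(f(x)-f(y))^2}{|x-y|^{d+\alpha}}\,dy\,\mu_V(dx).$$ *)

theory Defs
  imports "HOL-Analysis.Analysis"
begin

text \<open>
  The space \<open>\<real>\<^sup>d\<close> is a type of class \<open>euclidean_space\<close> with \<open>d = DIM('a)\<close>; this class
  enforces \<open>d \<ge> 1\<close>.  Nonnegative integrands are integrated in \<open>ennreal\<close>, so that no inequality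
  can hold merely because a Bochner integral of a non-integrable function is \<open>0\<close>.
\<close>

text \<open>
  \<open>iter_partial f [i\<^sub>1, \<dots>, i\<^sub>k]\<close> is \<open>\<partial>\<^sub>i\<^sub>1 \<dots> \<partial>\<^sub>i\<^sub>k f\<close> for basis vectors \<open>i\<^sub>1, \<dots>, i\<^sub>k\<close>.
\<close>

primrec iter_partial :: "('a::euclidean_space \<Rightarrow> real) \<Rightarrow> 'a list \<Rightarrow> 'a \<Rightarrow> real" where
  "iter_partial f [] = f"
| "iter_partial f (i # is) = (\<lambda>x. frechet_derivative (iter_partial f is) (at x) i)"

text \<open>
  Differentiability of the partial derivatives of every order makes all of them exist and be
  continuous, that is, \<open>f\<close> is smooth.
\<close>

definition Cb_infinity :: "('a::euclidean_space \<Rightarrow> real) set" where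
  "Cb_infinity = {f. \<forall>is \<in> lists Basis.
     (\<forall>x. iter_partial f is differentiable (at x)) \<and> bounded (range (iter_partial f is))}"

definition locally_bounded :: "('a::euclidean_space \<Rightarrow> real) \<Rightarrow> bool" where
  "locally_bounded V \<longleftrightarrow> (\<forall>x. \<exists>U. open U \<and> x \<in> U \<and> bounded (V ` U))"

definition norm_const :: "('a::euclidean_space \<Rightarrow> real) \<Rightarrow> real" where
  "norm_const V = inverse (\<integral>x. exp (- V x) \<partial>lborel)"

definition mu :: "('a::euclidean_space \<Rightarrow> real) \<Rightarrow> 'a measure" where
  "mu V = density lborel (\<lambda>x. ennreal (norm_const V * exp (- V x)))"

definition Dform :: "real \<Rightarrow> ('a::euclidean_space \<Rightarrow> real) \<Rightarrow> ('a \<Rightarrow> real) \<Rightarrow> ennreal" where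
  "Dform \<alpha> V f = ennreal (1 / 2) *
     (\<integral>\<^sup>+ x. (\<integral>\<^sup>+ y \<in> {y. norm (x - y) > 1}.
        ennreal ((f x - f y)\<^sup>2 / norm (x - y) powr (real DIM('a) + \<alpha>)) \<partial>lborel) \<partial>mu V)"

end

theory Submission
  imports Defs
begin

text \<open>
  Write \<open>p = d + \<alpha>\<close>, \<open>w(x) = 1 / (1 + \<bar>x\<bar>\<^sup>p)\<close> and let \<open>G(x)\<close> be the integral of
  \<open>(f(x) - f(z))\<^sup>2\<close> over those \<open>z\<close> in the ball of radius 3 with \<open>\<bar>x - z\<bar> > 1\<close>.  For any two
  points \<open>x, y\<close> a fixed volume of this ball is at distance \<open>> 1\<close> from both, so
  \<open>(f(x) - f(y))\<^sup>2\<close> is at most a constant times \<open>G(x) + G(y)\<close>, although short jumps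
  do not enter the form; and \<open>\<integral> w G\<close> is at most a constant times the form.  If \<open>\<mu>(f) = 0\<close>, then
  \<open>f(x)\<^sup>2 \<le> \<integral> (f(x) - f(y))\<^sup>2 \<mu>(dy)\<close>.  Integrating against \<open>w\<close>, which is integrable and
  dominates the density of \<open>\<mu>\<close>, gives the weighted Poincare inequality.

  For the second part let \<open>f\<^sub>n(x) = (1 + \<bar>x\<bar>\<^sup>2)\<^sup>-\<^sup>n\<close>.  The kernel has no singularity, so the form is
  bounded by \<open>\<mu>(f\<^sup>2)\<close> and the Lebesgue integral of \<open>f\<^sup>2\<close>, and for \<open>f\<^sub>n\<close> both
  are bounded by \<open>\<mu>(f\<^sub>n\<^sup>2)\<close> uniformly in \<open>n\<close>.  With \<open>s\<close> small and \<open>f\<^sub>n\<^sup>2 = f\<^sub>2\<^sub>n\<close> a super Poincare inequality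
  would give \<open>\<mu>(f\<^sub>2\<^sub>n) \<le> 2 \<beta>(s) \<mu>(f\<^sub>n)\<^sup>2\<close> with \<open>\<mu>(f\<^sub>n) \<longrightarrow> 0\<close>, hence exponential decay along a
  subsequence, whereas \<open>\<mu>(f\<^sub>n)\<close> decays more slowly than any exponential because
  \<open>\<mu>\<close> charges every neighbourhood of \<open>0\<close>.
\<close>

subsection \<open>The weight and the measure\<close>

text \<open>On the shell \<open>2^(n-1) <= norm x < 2^n\<close> the integrand is at most a multiple
  of \<open>2^(-n p)\<close>, while the ball of radius \<open>2^n\<close> has volume proportional to
  \<open>2^(n d)\<close>. The resulting series is geometric with ratio
  \<open>2^(d - p) < 1\<close>.\<close>

lemma nn_integral_inverse_one_plus_norm_powr_finite:
  fixes p :: real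
  assumes p: "real DIM('a::euclidean_space) < p"
  shows "(\<integral>\<^sup>+(x::'a). ennreal (1 / (1 + norm x powr p)) \<partial>lborel) < \<infinity>"
proof -
  \<comment> \<open>For \<open>n > 0\<close> this is \<open>(2^(n-1))^(-p)\<close>, the bound on the
    \<open>n\<close>-th shell; for \<open>n = 0\<close> it is at least 1, which covers the unit
    ball.\<close>
  define c where "c n = 2 powr p * 2 powr (- (real n * p))" for n
  let ?d = "real DIM('a)"
  let ?v = "unit_ball_vol ?d"
  let ?q = "2 powr (?d - p) :: real"
  have dyadic: "ennreal (1 / (1 + norm x powr p)) \<le> (\<Sum>n. ennreal (c n) * indicator (ball 0 (2 ^ n)) x)"
    for x :: 'a
  proof -
    obtain m where m: "norm x < 2 ^ m"
      using real_arch_pow[of 2 "norm x"] by auto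
    \<comment> \<open>Minimality supplies the lower bound \<open>2^(n-1) <= norm x\<close>; this
      single term of the series already dominates the integrand.\<close>
    define n where "n = (LEAST n. norm x < 2 ^ n)"
    have n: "norm x < 2 ^ n"
      unfolding n_def using m by (rule LeastI)
    have "1 / (1 + norm x powr p) \<le> c n"
    proof (cases n)
      case 0
      have "1 / (1 + norm x powr p) \<le> 1"
        by (simp add: divide_le_eq_1 add_pos_nonneg)
      also have "1 \<le> c n" using 0 p by (simp add: c_def ge_one_powr_ge_zero)
      finally show ?thesis .
    next
      case (Suc k)
      have "\<not> norm x < 2 ^ k"
        using not_less_Least[of k "\<lambda>n. norm x < 2 ^ n"] Suc unfolding n_def by auto
      then have "(2 ^ k) powr p \<le> norm x powr p"
        using p by (intro powr_mono2) auto
      then have "1 / (1 + norm x powr p) \<le> 1 / (2 ^ k) powr p"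
        by (intro divide_left_mono mult_pos_pos add_pos_nonneg) auto
      also have "\<dots> = 1 / 2 powr (real k * p)"
        by (simp add: powr_powr flip: powr_realpow)
      also have "\<dots> = c n"
        by (simp add: c_def Suc powr_minus field_simps flip: powr_add)
      finally show ?thesis .
    qed
    then have "ennreal (1 / (1 + norm x powr p)) \<le> ennreal (c n) * indicator (ball 0 (2 ^ n)) x"
      using n by (simp add: ennreal_leI)
    also have "\<dots> \<le> (\<Sum>n. ennreal (c n) * indicator (ball 0 (2 ^ n)) x)"
      using sum_le_suminf[OF summableI, of "{n}" "\<lambda>n. ennreal (c n) * indicator (ball 0 (2 ^ n)) x"]
      by (simp del: sum_mult_indicator)
    finally show ?thesis .
  qed
  have vol: "ennreal (c n) * emeasure lborel (ball (0::'a) (2 ^ n)) = ennreal (2 powr p * ?v * ?q ^ n)" for n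
  proof -
    have "2 powr (- (real n * p)) * (2 ^ n) ^ DIM('a) = ?q ^ n"
      by (simp add: powr_powr algebra_simps flip: powr_realpow powr_add)
    then have "c n * (?v * (2 ^ n) ^ DIM('a)) = 2 powr p * ?v * ?q ^ n"
      unfolding c_def by (metis mult.assoc mult.left_commute)
    then show ?thesis
      by (simp add: emeasure_ball c_def flip: ennreal_mult)
  qed
  have [measurable]: "(\<lambda>x::'a. ennreal (c n) * indicator (ball 0 (2 ^ n)) x) \<in> borel_measurable borel" for n
    by (intro borel_measurable_times_ennreal borel_measurable_indicator) auto
  have "?q < 1" using p powr_less_mono[of "?d - p" 0 2] by simp
  then have sm: "summable (\<lambda>n. 2 powr p * ?v * ?q ^ n)"
    by (intro summable_mult summable_geometric) simp
  have "(\<integral>\<^sup>+(x::'a). ennreal (1 / (1 + norm x powr p)) \<partial>lborel)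
    \<le> (\<integral>\<^sup>+(x::'a). (\<Sum>n. ennreal (c n) * indicator (ball 0 (2 ^ n)) x) \<partial>lborel)"
    by (intro nn_integral_mono dyadic)
  also have "\<dots> = (\<Sum>n. ennreal (2 powr p * ?v * ?q ^ n))"
    by (subst nn_integral_suminf) (auto simp: nn_integral_cmult_indicator vol)
  also have "\<dots> < \<infinity>"
    using sm by (subst suminf_ennreal2) auto
  finally show ?thesis .
qed

lemma locally_bounded_compact:
  fixes V :: "'a::euclidean_space \<Rightarrow> real"
  assumes V: "locally_bounded V" and K: "compact K"
  obtains M where "\<And>x. x \<in> K \<Longrightarrow> \<bar>V x\<bar> \<le> M"
proof -
  obtain U where U: "\<And>x. open (U x) \<and> x \<in> U x \<and> bounded (V ` U x)"
    using V unfolding locally_bounded_def by metis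
  obtain F where F: "F \<subseteq> K" "finite F" "K \<subseteq> (\<Union>x\<in>F. U x)"
    using compactE_image[OF K, of K U] U by (metis UN_I subsetI)
  have "bounded (\<Union>x\<in>F. V ` U x)"
    using F U by (intro bounded_UN) auto
  then obtain M where M: "\<And>y. y \<in> (\<Union>x\<in>F. V ` U x) \<Longrightarrow> norm y \<le> M"
    unfolding bounded_iff by blast
  show thesis
    by (rule that[of M]) (use F(3) M in fastforce)
qed

text \<open>A vanishing integral would make \<open>inverse\<close> return its default 0. It cannot
  vanish: \<open>exp (- V x)\<close> is nowhere 0, so the whole space would be a null set.\<close>

lemma norm_const_pos:
  fixes V :: "'a::euclidean_space \<Rightarrow> real"
  assumes "integrable lborel (\<lambda>x. exp (- V x))"
  shows "norm_const V > 0"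
proof -
  have "(\<integral>x. exp (- V x) \<partial>lborel) \<noteq> 0"
  proof
    assume "(\<integral>x. exp (- V x) \<partial>lborel) = 0"
    then have "AE x in lborel. x \<notin> (UNIV :: 'a set)"
      by (subst (asm) integral_nonneg_eq_0_iff_AE[OF assms]) auto
    then have "(UNIV :: 'a set) \<in> null_sets lborel"
      by (subst AE_iff_null_sets) auto
    then show False by auto
  qed
  moreover have "(\<integral>x. exp (- V x) \<partial>lborel) \<ge> 0" by simp
  ultimately show ?thesis
    by (simp add: norm_const_def order_less_le)
qed

lemma nn_integral_mu:
  assumes [measurable]: "V \<in> borel_measurable borel" "g \<in> borel_measurable borel"
  shows "(\<integral>\<^sup>+x. g x \<partial>mu V) = (\<integral>\<^sup>+x. ennreal (norm_const V * exp (- V x)) * g x \<partial>lborel)"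
  unfolding mu_def by (subst nn_integral_density) auto

lemma sets_mu [measurable_cong, simp]: "sets (mu V) = sets borel"
  by (simp add: mu_def)

lemma space_mu [simp]: "space (mu V) = UNIV"
  by (simp add: mu_def)

lemma emeasure_mu_UNIV:
  fixes V :: "'a::euclidean_space \<Rightarrow> real"
  assumes [measurable]: "V \<in> borel_measurable borel" and i: "integrable lborel (\<lambda>x. exp (- V x))"
  shows "emeasure (mu V) UNIV = 1"
proof -
  have "emeasure (mu V) UNIV = (\<integral>\<^sup>+x. 1 \<partial>mu V)"
    by simp
  also have "\<dots> = (\<integral>\<^sup>+x. ennreal (norm_const V * exp (- V x)) \<partial>lborel)"
    by (subst nn_integral_mu) auto
  also have "\<dots> = ennreal (\<integral>x. norm_const V * exp (- V x) \<partial>lborel)"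
    using norm_const_pos[OF i] i by (intro nn_integral_eq_integral) auto
  also have "\<dots> = 1"
    using norm_const_pos[OF i] by (simp add: norm_const_def)
  finally show ?thesis .
qed

text \<open>Lets Lebesgue integrals over a fixed ball be replaced, up to a constant, by integrals
  against \<open>mu V\<close>.\<close>

lemma mu_density_ge_on_cball:
  fixes V :: "'a::euclidean_space \<Rightarrow> real"
  assumes "locally_bounded V" "integrable lborel (\<lambda>x. exp (- V x))"
  obtains k where "k > 0" "\<And>x. norm x \<le> r \<Longrightarrow> k \<le> norm_const V * exp (- V x)"
proof -
  obtain M where M: "\<And>x. x \<in> cball 0 r \<Longrightarrow> \<bar>V x\<bar> \<le> M"
    using locally_bounded_compact[OF assms(1), of "cball 0 r"] by auto
  show thesis
  proof (rule that[of "norm_const V * exp (- M)"])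
    show "norm_const V * exp (- M) > 0" using norm_const_pos[OF assms(2)] by simp
    fix x :: 'a assume "norm x \<le> r"
    then have "V x \<le> M" using M[of x] by auto
    then show "norm_const V * exp (- M) \<le> norm_const V * exp (- V x)"
      using norm_const_pos[OF assms(2)] by (intro mult_left_mono) auto
  qed
qed

text \<open>The growth condition controls \<open>exp (- V x)\<close> outside a large ball, and local
  boundedness controls it inside. Equivalently, the weight
  \<open>exp (V x) / (1 + norm x powr p)\<close> is bounded away from 0.\<close>

lemma exp_neg_le_weight:
  fixes V :: "'a::euclidean_space \<Rightarrow> real"
  assumes V: "locally_bounded V" and p: "p > 0"
    and L: "Liminf at_infinity (\<lambda>x. ereal (exp (V x) / norm x powr p)) > 0"
  obtains C where "C > 0" "\<And>x. exp (- V x) \<le> C * (1 / (1 + norm x powr p))"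
proof -
  obtain c' :: ereal where c': "0 < c'" "c' < Liminf at_infinity (\<lambda>x. ereal (exp (V x) / norm x powr p))"
    using dense[OF L] by blast
  from less_LiminfD[OF c'(2)] obtain R where R: "\<And>x. norm x \<ge> R \<Longrightarrow> c' < ereal (exp (V x) / norm x powr p)"
    unfolding eventually_at_infinity by blast
  \<comment> \<open>The lower limit may be infinite, but \<open>c'\<close> lies strictly between 0
    and it, hence is real.\<close>
  obtain c where c: "c > 0" "\<And>x. norm x \<ge> R \<Longrightarrow> c < exp (V x) / norm x powr p"
  proof (cases c')
    case (real r) then show ?thesis using c'(1) R that[of r] by auto
  next
    case PInf then show ?thesis using c' by auto
  next
    case MInf then show ?thesis using c' by auto
  qed
  \<comment> \<open>Beyond radius 1 one has \<open>1 + norm x powr p <= 2 * norm x powr p\<close>,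
    which produces the constant \<open>2 / c\<close>.\<close>
  define S where "S = max R 1"
  obtain M where M: "\<And>x. x \<in> cball 0 S \<Longrightarrow> \<bar>V x\<bar> \<le> M"
    using locally_bounded_compact[OF V, of "cball 0 S"] by auto
  show thesis
  proof (rule that[of "max (2 / c) (exp M * (1 + S powr p))"])
    show "max (2 / c) (exp M * (1 + S powr p)) > 0" using c(1) by (simp add: less_max_iff_disj)
    fix x :: 'a
    have w: "1 + norm x powr p > 0" by (simp add: add_pos_nonneg)
    have "exp (- V x) * (1 + norm x powr p) \<le> max (2 / c) (exp M * (1 + S powr p))"
    proof (cases "norm x \<le> S")
      case True
      then have "exp (- V x) \<le> exp M" using M[of x] by auto
      moreover have "norm x powr p \<le> S powr p" using True p by (intro powr_mono2) auto
      ultimately have "exp (- V x) * (1 + norm x powr p) \<le> exp M * (1 + S powr p)"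
        by (intro mult_mono) auto
      then show ?thesis by simp
    next
      case False
      then have n: "norm x \<ge> R" "norm x \<ge> 1" unfolding S_def by auto
      have n1: "norm x powr p \<ge> 1" using n p by (simp add: ge_one_powr_ge_zero)
      have "c * norm x powr p < exp (V x)"
        using c(2)[OF n(1)] n1 by (subst (asm) pos_less_divide_eq) auto
      then have "c * (1 + norm x powr p) \<le> 2 * exp (V x)"
        using mult_left_mono[OF n1 less_imp_le[OF c(1)]] by (simp add: algebra_simps)
      then have "exp (- V x) * (1 + norm x powr p) \<le> 2 / c"
        using c(1) by (simp add: exp_minus field_simps)
      then show ?thesis by simp
    qed
    then show "exp (- V x) \<le> max (2 / c) (exp M * (1 + S powr p)) * (1 / (1 + norm x powr p))"
      using w by (simp add: field_simps)
  qed
qed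

subsection \<open>Jumps into a fixed ball\<close>

lemma ennreal_sq_diff_le:
  fixes a b c :: real
  shows "ennreal ((a - b)\<^sup>2) \<le> 2 * ennreal ((a - c)\<^sup>2) + 2 * ennreal ((b - c)\<^sup>2)"
proof -
  have "(a - b)\<^sup>2 \<le> 2 * (a - c)\<^sup>2 + 2 * (b - c)\<^sup>2"
    \<comment> \<open>The right side minus the left side is exactly this square.\<close>
    using zero_le_power2[of "a + b - 2 * c"] by (simp add: power2_eq_square algebra_simps)
  then have "ennreal ((a - b)\<^sup>2) \<le> ennreal (2 * (a - c)\<^sup>2 + 2 * (b - c)\<^sup>2)"
    by (rule ennreal_leI)
  also have "\<dots> = 2 * ennreal ((a - c)\<^sup>2) + 2 * ennreal ((b - c)\<^sup>2)"
    by (simp add: ennreal_plus ennreal_mult)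
  finally show ?thesis .
qed

text \<open>This is \<open>G\<close> of the opening text. The target \<open>z\<close> is confined to
  a ball because the density of \<open>mu V\<close> has a positive lower bound there.\<close>

definition far_energy :: "('a::euclidean_space \<Rightarrow> real) \<Rightarrow> 'a \<Rightarrow> ennreal" where
  "far_energy f x = (\<integral>\<^sup>+z. ennreal ((f x - f z)\<^sup>2) * indicator {z. norm z < 3 \<and> norm (z - x) > 1} z \<partial>lborel)"

text \<open>The indicated set varies with \<open>x\<close>; the conditional form makes joint
  measurability in \<open>x\<close> and \<open>z\<close> accessible to
  \<open>measurable\<close>.\<close>

lemma far_energy_if:
  "far_energy f x = (\<integral>\<^sup>+z. (if norm z < 3 \<and> norm (z - x) > 1 then ennreal ((f x - f z)\<^sup>2) else 0) \<partial>lborel)"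
  unfolding far_energy_def by (intro nn_integral_cong) auto

lemma borel_measurable_far_energy [measurable]:
  assumes [measurable]: "f \<in> borel_measurable borel"
  shows "far_energy f \<in> borel_measurable borel"
proof -
  have "(\<lambda>x. \<integral>\<^sup>+z. (if norm z < 3 \<and> norm (z - x) > 1 then ennreal ((f x - f z)\<^sup>2) else 0) \<partial>lborel)
    \<in> borel_measurable borel"
    by measurable
  then show ?thesis
    by (simp add: far_energy_if[abs_def])
qed

lemma far_common_points:
  fixes x y :: "'a::euclidean_space"
  shows "emeasure lborel (ball (0::'a) 1)
    \<le> emeasure lborel {z. norm z < 3 \<and> norm (z - x) > 1 \<and> norm (z - y) > 1}"
proof -
  define A where "A = {z. norm z < 3 \<and> norm (z - x) > 1 \<and> norm (z - y) > 1}"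
  let ?v = "unit_ball_vol (real DIM('a))"
  have A: "A \<in> sets borel" unfolding A_def by measurable
  \<comment> \<open>\<open>3\<^sup>d - 2 \<ge> 1\<close>, so the ball of radius 3 is not exhausted by two unit balls\<close>
  have "ball 0 3 \<subseteq> A \<union> cball x 1 \<union> cball y 1"
    by (auto simp: A_def dist_norm norm_minus_commute)
  then have "emeasure lborel (ball (0::'a) 3) \<le> emeasure lborel (A \<union> cball x 1 \<union> cball y 1)"
    using A by (intro emeasure_mono) auto
  also have "\<dots> \<le> emeasure lborel (A \<union> cball x 1) + emeasure lborel (cball y 1)"
    using A by (intro emeasure_subadditive) auto
  also have "\<dots> \<le> emeasure lborel A + emeasure lborel (cball x 1) + emeasure lborel (cball y 1)"
    using A by (intro add_right_mono emeasure_subadditive) auto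
  finally have *: "ennreal (?v * 3 ^ DIM('a)) \<le> emeasure lborel A + ennreal ?v + ennreal ?v"
    by (simp add: emeasure_ball emeasure_cball)
  have "(3::real) ^ 1 \<le> 3 ^ DIM('a)"
    by (intro power_increasing) (auto simp: Suc_leI)
  then have "?v * 3 \<le> ?v * 3 ^ DIM('a)"
    by (intro mult_left_mono) auto
  then have "ennreal (?v * 3) \<le> ennreal (?v * 3 ^ DIM('a))"
    by (rule ennreal_leI)
  also have "\<dots> \<le> ennreal (?v + ?v) + emeasure lborel A"
    using * by (subst ennreal_plus) (auto simp: ac_simps)
  finally have "ennreal (?v * 3) \<le> ennreal (?v + ?v) + emeasure lborel A" .
  moreover have "ennreal (?v * 3) = ennreal (?v + ?v) + ennreal ?v"
    by (subst ennreal_plus[symmetric]) auto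
  ultimately have "ennreal (?v + ?v) + ennreal ?v \<le> ennreal (?v + ?v) + emeasure lborel A"
    by simp
  then have "ennreal ?v \<le> emeasure lborel A"
    by (subst (asm) ennreal_add_left_cancel_le) auto
  then show ?thesis by (simp add: emeasure_ball A_def)
qed

text \<open>Each \<open>z\<close> far from both points serves as an intermediate stop:
  \<open>f x - f y\<close> is split at \<open>f z\<close>. Integrating over all such
  \<open>z\<close>, whose volume is bounded below by \<open>far_common_points\<close>, gives the
  claim.\<close>

lemma sq_diff_le_far_energy:
  fixes f :: "'a::euclidean_space \<Rightarrow> real"
  assumes [measurable]: "f \<in> borel_measurable borel"
  shows "emeasure lborel (ball (0::'a) 1) * ennreal ((f x - f y)\<^sup>2) \<le> 2 * (far_energy f x + far_energy f y)"
proof -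
  let ?A = "{z. norm z < 3 \<and> norm (z - x) > 1 \<and> norm (z - y) > 1}"
  let ?e = "\<lambda>x z. ennreal ((f x - f z)\<^sup>2) * indicator {z. norm z < 3 \<and> norm (z - x) > 1} z"
  have "emeasure lborel (ball (0::'a) 1) * ennreal ((f x - f y)\<^sup>2)
    \<le> ennreal ((f x - f y)\<^sup>2) * emeasure lborel ?A"
    using far_common_points[of x y] by (subst mult.commute) (intro mult_left_mono, auto)
  also have "\<dots> = (\<integral>\<^sup>+z. ennreal ((f x - f y)\<^sup>2) * indicator ?A z \<partial>lborel)"
    by (rule nn_integral_cmult_indicator[symmetric]) measurable
  also have "\<dots> \<le> (\<integral>\<^sup>+z. 2 * ?e x z + 2 * ?e y z \<partial>lborel)"
    using ennreal_sq_diff_le by (intro nn_integral_mono) (auto simp: indicator_def)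
  also have "\<dots> = 2 * (far_energy f x + far_energy f y)"
    unfolding far_energy_def by (simp add: nn_integral_add nn_integral_cmult distrib_left)
  finally show ?thesis .
qed

lemma weight_le_kernel:
  fixes x z :: "'a::euclidean_space"
  assumes p: "p > 0" and z: "norm z < 3" "norm (z - x) > 1"
  shows "1 / (1 + norm x powr p) \<le> 4 powr p / norm (z - x) powr p"
proof -
  \<comment> \<open>The factor 4 is 3, from the radius of the ball, plus 1, from
    \<open>norm x\<close> itself.\<close>
  have "norm (z - x) \<le> 4 * max 1 (norm x)"
    using norm_triangle_ineq4[of z x] z by auto
  then have "norm (z - x) powr p \<le> (4 * max 1 (norm x)) powr p"
    using p by (intro powr_mono2) auto
  also have "\<dots> = 4 powr p * max 1 (norm x) powr p"
    by (simp add: powr_mult)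
  also have "\<dots> \<le> 4 powr p * (1 + norm x powr p)"
    by (intro mult_left_mono) (auto simp: max_def)
  finally have "norm (z - x) powr p \<le> 4 powr p * (1 + norm x powr p)" .
  moreover have "norm (z - x) powr p > 0" using z by auto
  moreover have "1 + norm x powr p > 0" by (simp add: add_pos_nonneg)
  ultimately show ?thesis by (simp add: field_simps)
qed

text \<open>The point \<open>z\<close> in the ball plays the part of the variable integrated against
  \<open>mu V\<close>, at the cost of a factor \<open>1 / k\<close>; the free point \<open>x\<close>
  carries the weight, which \<open>weight_le_kernel\<close> bounds by the jump kernel. Tonelli
  exchanges the two integrals.\<close>

lemma far_energy_le_Dform:
  fixes V :: "'a::euclidean_space \<Rightarrow> real"
  assumes \<alpha>: "\<alpha> > 0" and [measurable]: "V \<in> borel_measurable borel"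
    and V: "locally_bounded V" "integrable lborel (\<lambda>x. exp (- V x))"
  defines "p \<equiv> real DIM('a) + \<alpha>"
  obtains C where "C > 0" "\<And>f. f \<in> borel_measurable borel \<Longrightarrow>
    (\<integral>\<^sup>+x. ennreal (1 / (1 + norm x powr p)) * far_energy f x \<partial>lborel) \<le> ennreal C * Dform \<alpha> V f"
proof -
  obtain k where k: "k > 0" "\<And>x. norm x \<le> 3 \<Longrightarrow> k \<le> norm_const V * exp (- V x)"
    using mu_density_ge_on_cball[OF V, of 3] by auto
  have p: "p > 0" using \<alpha> by (simp add: p_def add_pos_pos)
  \<comment> \<open>The 2 cancels the prefactor \<open>1 / 2\<close> of the form.\<close>
  let ?C = "2 * 4 powr p / k"
  have "(\<integral>\<^sup>+x. ennreal (1 / (1 + norm x powr p)) * far_energy f x \<partial>lborel) \<le> ennreal ?C * Dform \<alpha> V f"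
    if [measurable]: "f \<in> borel_measurable borel" for f
  proof -
    let ?w = "\<lambda>x. ennreal (1 / (1 + norm x powr p))"
    let ?\<nu> = "\<lambda>z. ennreal (norm_const V * exp (- V z))"
    let ?K = "\<lambda>z x. ennreal ((f z - f x)\<^sup>2 / norm (z - x) powr p) * indicator {x. norm (z - x) > 1} x"
    define F where "F x z = ?w x * (if norm z < 3 \<and> norm (z - x) > 1 then ennreal ((f x - f z)\<^sup>2) else 0)"
      for x z
    have [measurable]: "case_prod F \<in> borel_measurable (borel \<Otimes>\<^sub>M borel)"
      unfolding F_def by measurable
    have K[measurable]: "case_prod ?K \<in> borel_measurable (borel \<Otimes>\<^sub>M borel)"
    proof -
      have "?K = (\<lambda>z x. if norm (z - x) > 1 then ennreal ((f z - f x)\<^sup>2 / norm (z - x) powr p) else 0)"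
        by (auto simp: fun_eq_iff)
      then show ?thesis by simp
    qed
    have F: "F x z \<le> ennreal (4 powr p / k) * (?\<nu> z * ?K z x)" for x z
    proof (cases "norm z < 3 \<and> norm (z - x) > 1")
      case True
      have "1 / (1 + norm x powr p) * (f x - f z)\<^sup>2 \<le> 4 powr p / norm (z - x) powr p * (f x - f z)\<^sup>2"
        using weight_le_kernel[of p z x] p True by (intro mult_right_mono) auto
      also have "\<dots> = 4 powr p / k * (k * ((f z - f x)\<^sup>2 / norm (z - x) powr p))"
        using k(1) by (simp add: power2_commute)
      also have "\<dots> \<le> 4 powr p / k * ((norm_const V * exp (- V z)) * ((f z - f x)\<^sup>2 / norm (z - x) powr p))"
        using k True by (intro mult_left_mono mult_right_mono) auto
      finally show ?thesis
        using True k norm_const_pos[OF V(2)] by (simp add: F_def ennreal_leI flip: ennreal_mult)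
    next
      case False
      then show ?thesis by (auto simp: F_def)
    qed
    have "(\<integral>\<^sup>+x. ?w x * far_energy f x \<partial>lborel) = (\<integral>\<^sup>+x. (\<integral>\<^sup>+z. F x z \<partial>lborel) \<partial>lborel)"
      unfolding far_energy_if F_def by (intro nn_integral_cong nn_integral_cmult[symmetric]) measurable
    also have "\<dots> = (\<integral>\<^sup>+z. (\<integral>\<^sup>+x. F x z \<partial>lborel) \<partial>lborel)"
      by (rule lborel_pair.Fubini') simp
    also have "\<dots> \<le> (\<integral>\<^sup>+z. (\<integral>\<^sup>+x. ennreal (4 powr p / k) * (?\<nu> z * ?K z x) \<partial>lborel) \<partial>lborel)"
      by (intro nn_integral_mono F)
    also have "\<dots> = (\<integral>\<^sup>+z. ennreal (4 powr p / k) * (?\<nu> z * (\<integral>\<^sup>+x. ?K z x \<partial>lborel)) \<partial>lborel)"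
      by (intro nn_integral_cong) (simp add: nn_integral_cmult)
    also have "\<dots> = ennreal (4 powr p / k) * (\<integral>\<^sup>+z. ?\<nu> z * (\<integral>\<^sup>+x. ?K z x \<partial>lborel) \<partial>lborel)"
      by (rule nn_integral_cmult) simp
    also have "\<dots> = ennreal (4 powr p / k) * (\<integral>\<^sup>+z. (\<integral>\<^sup>+x. ?K z x \<partial>lborel) \<partial>mu V)"
      by (subst nn_integral_mu) simp_all
    also have "ennreal (4 powr p / k) = ennreal ?C * ennreal (1 / 2)"
      using k by (subst ennreal_mult[symmetric]) auto
    finally show ?thesis
      by (simp add: Dform_def p_def mult.assoc)
  qed
  then show thesis
    using k by (intro that[of ?C]) auto
qed

section \<open>From far jumps to the weighted and the plain Poincare inequality\<close>

text \<open>For a probability measure and mean zero the cross term vanishes, so the right side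
  equals \<open>c^2\<close> plus the integral of \<open>f^2\<close>.\<close>

lemma sq_le_nn_integral_sq_diff:
  assumes f: "integrable M f" "integrable M (\<lambda>x. (f x)\<^sup>2)" "(\<integral>x. f x \<partial>M) = 0"
    and M: "emeasure M (space M) = 1"
  shows "ennreal (c\<^sup>2) \<le> (\<integral>\<^sup>+x. ennreal ((c - f x)\<^sup>2) \<partial>M)"
proof -
  have "finite_measure M" by (rule finite_measureI) (simp add: M)
  then have c: "integrable M (\<lambda>_. c\<^sup>2)"
    by (simp add: finite_measure.integrable_const)
  have e: "(\<lambda>x. (c - f x)\<^sup>2) = (\<lambda>x. c\<^sup>2 - 2 * c * f x + (f x)\<^sup>2)"
    by (auto simp: fun_eq_iff power2_eq_square algebra_simps)
  have "(\<integral>x. (c - f x)\<^sup>2 \<partial>M) = c\<^sup>2 + (\<integral>x. (f x)\<^sup>2 \<partial>M)"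
    unfolding e using f c by (simp add: measure_def M)
  moreover have "(\<integral>x. (f x)\<^sup>2 \<partial>M) \<ge> 0" by simp
  moreover have "(\<integral>\<^sup>+x. ennreal ((c - f x)\<^sup>2) \<partial>M) = ennreal (\<integral>x. (c - f x)\<^sup>2 \<partial>M)"
    by (rule nn_integral_eq_integral) (use f c e in auto)
  ultimately show ?thesis by (simp add: ennreal_leI)
qed

lemma Cb_infinity_measurable [measurable (raw)]:
  assumes "f \<in> Cb_infinity"
  shows "f \<in> borel_measurable borel"
proof -
  have "\<forall>x. f differentiable (at x)"
    \<comment> \<open>The empty list of directions stands for \<open>f\<close> itself.\<close>
    using assms unfolding Cb_infinity_def by (force dest: bspec[of _ _ "[]"])
  then have "continuous_on UNIV f"
    by (simp add: continuous_at_imp_continuous_on differentiable_imp_continuous_within)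
  then show ?thesis by (rule borel_measurable_continuous_onI)
qed

lemma Cb_infinity_bounded:
  assumes "f \<in> Cb_infinity"
  obtains B where "\<And>x. \<bar>f x\<bar> \<le> B"
proof -
  have "bounded (range f)"
    using assms unfolding Cb_infinity_def by (force dest: bspec[of _ _ "[]"])
  then show thesis
    using that unfolding bounded_iff by auto
qed

lemma integrable_mu_bounded:
  fixes V :: "'a::euclidean_space \<Rightarrow> real" and f :: "'a \<Rightarrow> real"
  assumes [measurable]: "V \<in> borel_measurable borel" and i: "integrable lborel (\<lambda>x. exp (- V x))"
    and [measurable]: "f \<in> borel_measurable borel" and "\<And>x. \<bar>f x\<bar> \<le> B"
  shows "integrable (mu V) f"
proof -
  interpret finite_measure "mu V"
    by (rule finite_measureI) (simp add: emeasure_mu_UNIV[OF assms(1) i])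
  show ?thesis
    by (rule integrable_const_bound[of _ B]) (use assms in auto)
qed

lemma weighted_poincare:
  fixes V :: "'a::euclidean_space \<Rightarrow> real"
  assumes \<alpha>: "\<alpha> > 0" and Vm[measurable]: "V \<in> borel_measurable borel"
    and V: "locally_bounded V" "integrable lborel (\<lambda>x. exp (- V x))"
  defines "p \<equiv> real DIM('a) + \<alpha>"
  assumes L: "Liminf at_infinity (\<lambda>x. ereal (exp (V x) / norm x powr p)) > 0"
  obtains C where "C > 0" "\<And>f. f \<in> Cb_infinity \<Longrightarrow> (\<integral>x. f x \<partial>mu V) = 0 \<Longrightarrow>
    (\<integral>\<^sup>+x. ennreal ((f x)\<^sup>2 * (exp (V x) / (1 + norm x powr p))) \<partial>mu V) \<le> ennreal C * Dform \<alpha> V f"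
proof -
  let ?w = "\<lambda>x::'a. 1 / (1 + norm x powr p)"
  let ?v = "unit_ball_vol (real DIM('a))"
  note nc = norm_const_pos[OF V(2)]
  have p: "p > 0" using \<alpha> by (simp add: p_def add_pos_pos)
  have w0: "?w x \<ge> 0" for x by (simp add: add_nonneg_nonneg)
  obtain C1 where C1: "C1 > 0" "\<And>f. f \<in> borel_measurable borel \<Longrightarrow>
    (\<integral>\<^sup>+x. ennreal (?w x) * far_energy f x \<partial>lborel) \<le> ennreal C1 * Dform \<alpha> V f"
    using far_energy_le_Dform[OF \<alpha> Vm V, folded p_def] by blast
  obtain C2 where C2: "C2 > 0" "\<And>x. exp (- V x) \<le> C2 * ?w x"
    using exp_neg_le_weight[OF V(1) p L] by blast
  obtain W where W: "W \<ge> 0" "(\<integral>\<^sup>+x. ennreal (?w x) \<partial>lborel) = ennreal W"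
  proof -
    have "real DIM('a) < p" using \<alpha> by (simp add: p_def)
    from nn_integral_inverse_one_plus_norm_powr_finite[OF this]
    have "(\<integral>\<^sup>+x. ennreal (?w x) \<partial>lborel) < \<infinity>" .
    then show ?thesis
      using that by (cases "\<integral>\<^sup>+x. ennreal (?w x) \<partial>lborel") auto
  qed
  let ?N = "norm_const V"
  \<comment> \<open>\<open>?N\<close> remains when \<open>exp (V x)\<close> cancels against the
    density; \<open>2 / ?v\<close> comes from \<open>sq_diff_le_far_energy\<close>. In the bracket,
    1 accounts for the far energy at \<open>x\<close> and the other summand for its
    \<open>mu V\<close>-average, integrated against the weight of total mass \<open>W\<close>.
    \<open>C1\<close> passes to the form.\<close>
  let ?C = "?N / ?v * 2 * (1 + W * (?N * C2)) * C1"
  have "(\<integral>\<^sup>+x. ennreal ((f x)\<^sup>2 * (exp (V x) / (1 + norm x powr p))) \<partial>mu V) \<le> ennreal ?C * Dform \<alpha> V f"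
    if f: "f \<in> Cb_infinity" and f0: "(\<integral>x. f x \<partial>mu V) = 0" for f
  proof -
    have fm[measurable]: "f \<in> borel_measurable borel" by (rule Cb_infinity_measurable[OF f])
    obtain B where B: "\<And>x. \<bar>f x\<bar> \<le> B" using Cb_infinity_bounded[OF f] by blast
    have B2: "\<bar>(f x)\<^sup>2\<bar> \<le> B\<^sup>2" for x using power_mono[OF B[of x], of 2] by simp
    have f_int: "integrable (mu V) f"
      by (rule integrable_mu_bounded[OF Vm V(2) fm B])
    have f2_int: "integrable (mu V) (\<lambda>x. (f x)\<^sup>2)"
      by (rule integrable_mu_bounded[OF Vm V(2) _ B2]) measurable
    define E where "E = (\<integral>\<^sup>+x. ennreal (?w x) * far_energy f x \<partial>lborel)"
    \<comment> \<open>The density of \<open>mu V\<close> is at most \<open>?N * C2\<close> times the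
      weight, so \<open>E\<close> controls this average too.\<close>
    have Emu: "(\<integral>\<^sup>+y. far_energy f y \<partial>mu V) \<le> ennreal (?N * C2) * E"
    proof -
      have "(\<integral>\<^sup>+y. far_energy f y \<partial>mu V) = (\<integral>\<^sup>+y. ennreal (?N * exp (- V y)) * far_energy f y \<partial>lborel)"
        by (rule nn_integral_mu) measurable
      also have "\<dots> \<le> (\<integral>\<^sup>+y. ennreal (?N * C2) * (ennreal (?w y) * far_energy f y) \<partial>lborel)"
      proof (intro nn_integral_mono)
        fix y
        have "?N * exp (- V y) \<le> ?N * C2 * ?w y"
          using mult_left_mono[OF C2(2)[of y] less_imp_le[OF nc]] by (simp only: mult.assoc)
        then have "ennreal (?N * exp (- V y)) \<le> ennreal (?N * C2) * ennreal (?w y)"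
          using nc C2(1) w0 by (subst ennreal_mult[symmetric]) (auto intro!: ennreal_leI)
        then show "ennreal (?N * exp (- V y)) * far_energy f y
          \<le> ennreal (?N * C2) * (ennreal (?w y) * far_energy f y)"
          by (simp add: mult_right_mono flip: mult.assoc)
      qed
      also have "\<dots> = ennreal (?N * C2) * E"
        unfolding E_def by (rule nn_integral_cmult) measurable
      finally show ?thesis .
    qed
    have pointwise: "ennreal ?v * ennreal ((f x)\<^sup>2) \<le> 2 * (far_energy f x + ennreal (?N * C2) * E)" for x
    proof -
      have "ennreal ?v * ennreal ((f x)\<^sup>2) \<le> ennreal ?v * (\<integral>\<^sup>+y. ennreal ((f x - f y)\<^sup>2) \<partial>mu V)"
        using emeasure_mu_UNIV[OF Vm V(2)]
        by (intro mult_left_mono sq_le_nn_integral_sq_diff f_int f2_int f0) simp_all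
      also have "\<dots> = (\<integral>\<^sup>+y. ennreal ?v * ennreal ((f x - f y)\<^sup>2) \<partial>mu V)"
        by (rule nn_integral_cmult[symmetric]) measurable
      also have "\<dots> \<le> (\<integral>\<^sup>+y. 2 * (far_energy f x + far_energy f y) \<partial>mu V)"
        using sq_diff_le_far_energy[OF fm, of x] by (intro nn_integral_mono) (simp add: emeasure_ball)
      also have "\<dots> = 2 * (far_energy f x + (\<integral>\<^sup>+y. far_energy f y \<partial>mu V))"
        by (simp add: nn_integral_cmult nn_integral_add emeasure_mu_UNIV[OF Vm V(2)])
      also have "\<dots> \<le> 2 * (far_energy f x + ennreal (?N * C2) * E)"
        using Emu by (intro mult_left_mono add_left_mono) auto
      finally show ?thesis .
    qed
    have "(\<integral>\<^sup>+x. ennreal ((f x)\<^sup>2 * (exp (V x) / (1 + norm x powr p))) \<partial>mu V)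
      = (\<integral>\<^sup>+x. ennreal (?N * exp (- V x)) * ennreal ((f x)\<^sup>2 * (exp (V x) / (1 + norm x powr p))) \<partial>lborel)"
      by (rule nn_integral_mu) measurable
    \<comment> \<open>The factor \<open>?v\<close> is inserted and divided out so that
      \<open>pointwise\<close> applies.\<close>
    also have "\<dots> = (\<integral>\<^sup>+x. ennreal (?N / ?v) * (ennreal (?w x) * (ennreal ?v * ennreal ((f x)\<^sup>2))) \<partial>lborel)"
    proof (intro nn_integral_cong)
      fix x
      have v: "?v > 0" by simp
      have ev: "exp (- V x) * exp (V x) = 1" by (simp flip: exp_add)
      have "?N * exp (- V x) * ((f x)\<^sup>2 * (exp (V x) / (1 + norm x powr p)))
        = (exp (- V x) * exp (V x)) * (?N * (f x)\<^sup>2 * ?w x)" by simp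
      also have "\<dots> = ?N / ?v * (?w x * (?v * (f x)\<^sup>2))"
        using v ev by (simp del: unit_ball_vol_pos)
      finally show "ennreal (?N * exp (- V x)) * ennreal ((f x)\<^sup>2 * (exp (V x) / (1 + norm x powr p)))
        = ennreal (?N / ?v) * (ennreal (?w x) * (ennreal ?v * ennreal ((f x)\<^sup>2)))"
        using nc w0[of x] by (simp add: add_nonneg_nonneg flip: ennreal_mult)
    qed
    also have "\<dots> \<le> (\<integral>\<^sup>+x. ennreal (?N / ?v) * (ennreal (?w x) * (2 * (far_energy f x + ennreal (?N * C2) * E))) \<partial>lborel)"
      by (intro nn_integral_mono mult_left_mono pointwise) auto
    also have "\<dots> = ennreal (?N / ?v) * (2 * (\<integral>\<^sup>+x. ennreal (?w x) * far_energy f x + (ennreal (?N * C2) * E) * ennreal (?w x) \<partial>lborel))"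
      by (subst nn_integral_cmult[symmetric], measurable)+ (simp add: algebra_simps)
    also have "\<dots> = ennreal (?N / ?v) * (2 * (E + (ennreal (?N * C2) * E) * ennreal W))"
      by (subst nn_integral_add) (auto simp: nn_integral_cmult W(2) E_def)
    also have "\<dots> = ennreal (?N / ?v * 2 * (1 + W * (?N * C2))) * E"
    proof -
      have const: "ennreal (a * 2 * (1 + b * c)) = ennreal a * (2 * (1 + ennreal b * ennreal c))"
        if "a \<ge> 0" "b \<ge> 0" "c \<ge> 0" for a b c :: real
        using that by (simp add: ennreal_mult ennreal_plus mult.assoc)
      have split: "E + ennreal (?N * C2) * E * ennreal W = (1 + ennreal W * ennreal (?N * C2)) * E"
        by (subst distrib_right) (simp add: ac_simps)
      have "?N / ?v \<ge> 0" "?N * C2 \<ge> 0" using nc C2(1) by auto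
      from const[OF this(1) W(1) this(2)] show ?thesis
        unfolding split by (simp only: mult.assoc)
    qed
    also have "\<dots> \<le> ennreal (?N / ?v * 2 * (1 + W * (?N * C2))) * (ennreal C1 * Dform \<alpha> V f)"
      unfolding E_def by (intro mult_left_mono C1) auto
    also have "\<dots> = ennreal ?C * Dform \<alpha> V f"
      using nc C1(1) C2(1) W(1) by (subst (2) ennreal_mult) (auto simp: mult.assoc)
    finally show ?thesis .
  qed
  moreover have "?C > 0"
    using nc C1(1) C2(1) W(1) by (intro mult_pos_pos divide_pos_pos add_pos_nonneg) auto
  ultimately show thesis by (rule that[rotated])
qed

text \<open>Multiplying the bound of \<open>exp_neg_le_weight\<close> by \<open>exp (V x)\<close>
  shows that the weight is at least \<open>1 / c\<close>.\<close>

lemma mu_sq_le_weighted: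
  fixes V :: "'a::euclidean_space \<Rightarrow> real"
  assumes [measurable]: "V \<in> borel_measurable borel" and V: "locally_bounded V" and p: "p > 0"
    and L: "Liminf at_infinity (\<lambda>x. ereal (exp (V x) / norm x powr p)) > 0"
  obtains c where "c > 0" "\<And>f. f \<in> borel_measurable borel \<Longrightarrow> (\<integral>\<^sup>+x. ennreal ((f x)\<^sup>2) \<partial>mu V)
    \<le> ennreal c * (\<integral>\<^sup>+x. ennreal ((f x)\<^sup>2 * (exp (V x) / (1 + norm x powr p))) \<partial>mu V)"
proof -
  obtain c where c: "c > 0" "\<And>x. exp (- V x) \<le> c * (1 / (1 + norm x powr p))"
    using exp_neg_le_weight[OF V p L] by blast
  have "(\<integral>\<^sup>+x. ennreal ((f x)\<^sup>2) \<partial>mu V)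
      \<le> ennreal c * (\<integral>\<^sup>+x. ennreal ((f x)\<^sup>2 * (exp (V x) / (1 + norm x powr p))) \<partial>mu V)"
    if [measurable]: "f \<in> borel_measurable borel" for f
  proof -
    have "(f x)\<^sup>2 \<le> c * ((f x)\<^sup>2 * (exp (V x) / (1 + norm x powr p)))" for x
    proof -
      have "1 = exp (- V x) * exp (V x)" by (simp flip: exp_add)
      also have "\<dots> \<le> c * (1 / (1 + norm x powr p)) * exp (V x)"
        using c(2)[of x] by (intro mult_right_mono) auto
      finally show ?thesis
        using mult_left_mono[of 1 "c * (1 / (1 + norm x powr p)) * exp (V x)" "(f x)\<^sup>2"] by (simp add: ac_simps)
    qed
    then have "(\<integral>\<^sup>+x. ennreal ((f x)\<^sup>2) \<partial>mu V)
      \<le> (\<integral>\<^sup>+x. ennreal c * ennreal ((f x)\<^sup>2 * (exp (V x) / (1 + norm x powr p))) \<partial>mu V)"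
      using c(1) by (intro nn_integral_mono) (simp add: add_nonneg_nonneg ennreal_leI flip: ennreal_mult)
    also have "\<dots> = ennreal c * (\<integral>\<^sup>+x. ennreal ((f x)\<^sup>2 * (exp (V x) / (1 + norm x powr p))) \<partial>mu V)"
      by (rule nn_integral_cmult) measurable
    finally show ?thesis .
  qed
  then show thesis using c(1) that by blast
qed

subsection \<open>Smooth test functions peaked at the origin\<close>

text \<open>
  An algebra of bounded functions that is closed under partial derivatives; it provides
  localized functions in \<open>Cb_infinity\<close> without constructing compactly supported ones.
\<close>

inductive_set cauchy_algebra :: "('a::euclidean_space \<Rightarrow> real) set" where
  const: "(\<lambda>x. c) \<in> cauchy_algebra"
| base: "(\<lambda>x. 1 / (1 + x \<bullet> x)) \<in> cauchy_algebra"
| coord: "(\<lambda>x. (x \<bullet> b) / (1 + x \<bullet> x)) \<in> cauchy_algebra"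
| add: "f \<in> cauchy_algebra \<Longrightarrow> g \<in> cauchy_algebra \<Longrightarrow> (\<lambda>x. f x + g x) \<in> cauchy_algebra"
| mult: "f \<in> cauchy_algebra \<Longrightarrow> g \<in> cauchy_algebra \<Longrightarrow> (\<lambda>x. f x * g x) \<in> cauchy_algebra"

lemma cauchy_algebra_bounded:
  assumes "f \<in> cauchy_algebra"
  shows "bounded (range f)"
proof -
  have "\<exists>B. \<forall>x. \<bar>f x\<bar> \<le> B"
    using assms
  proof induction
    case (const c)
    then show ?case by auto
  next
    case base
    show ?case
      by (rule exI[of _ 1]) (simp add: divide_le_eq_1 add_pos_nonneg)
  next
    case (coord b)
    show ?case
    proof (intro exI[of _ "norm b"] allI)
      fix x :: 'a
      \<comment> \<open>Expanding \<open>(norm x - 1)^2 >= 0\<close> gives this, so the denominator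
        absorbs the linear growth of the numerator.\<close>
      have "2 * norm x \<le> 1 + x \<bullet> x"
        using zero_le_power2[of "norm x - 1"]
        by (simp add: power2_eq_square algebra_simps flip: power2_norm_eq_inner)
      then have "norm x \<le> 1 + x \<bullet> x" using norm_ge_zero[of x] by linarith
      then have "norm x * norm b \<le> (1 + x \<bullet> x) * norm b"
        by (rule mult_right_mono) simp
      then have "\<bar>x \<bullet> b\<bar> \<le> norm b * (1 + x \<bullet> x)"
        using Cauchy_Schwarz_ineq2[of x b] by (simp add: mult.commute)
      moreover have "1 + x \<bullet> x > 0" by (simp add: add_pos_nonneg)
      ultimately show "\<bar>(x \<bullet> b) / (1 + x \<bullet> x)\<bar> \<le> norm b"
        by (simp add: abs_divide pos_divide_le_eq)
    qed
  next
    case (add f g)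
    then obtain A B where "\<And>x. \<bar>f x\<bar> \<le> A" "\<And>x. \<bar>g x\<bar> \<le> B" by blast
    then have "\<bar>f x + g x\<bar> \<le> A + B" for x
      using abs_triangle_ineq[of "f x" "g x"] by (meson add_mono order_trans)
    then show ?case by blast
  next
    case (mult f g)
    then obtain A B where AB: "\<And>x. \<bar>f x\<bar> \<le> A" "\<And>x. \<bar>g x\<bar> \<le> B" by blast
    have "\<bar>f x * g x\<bar> \<le> A * B" for x
      unfolding abs_mult using AB[of x] by (intro mult_mono) (auto intro: order_trans[OF abs_ge_zero])
    then show ?case by blast
  qed
  then show ?thesis unfolding bounded_iff by auto
qed

text \<open>The generators are closed under differentiation up to products: with
  \<open>u = 1 / (1 + x \<bullet> x)\<close> and \<open>v_b = (x \<bullet> b) * u\<close>, the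
  derivatives in direction \<open>h\<close> are \<open>-2 * u * v_h\<close> and
  \<open>(h \<bullet> b) * u - 2 * v_b * v_h\<close>. Sums and products follow from linearity and
  the product rule.\<close>

lemma cauchy_algebra_derivative:
  assumes "f \<in> cauchy_algebra"
  obtains D where "\<And>x. (f has_derivative D x) (at x)" "\<And>b. (\<lambda>x. D x b) \<in> cauchy_algebra"
proof -
  have "\<exists>D. (\<forall>x. (f has_derivative D x) (at x)) \<and> (\<forall>b. (\<lambda>x. D x b) \<in> cauchy_algebra)"
    using assms
  proof induction
    case (const c)
    then show ?case
      by (intro exI[of _ "\<lambda>x h. 0"]) (auto intro: cauchy_algebra.intros)
  next
    case base
    let ?D = "\<lambda>x h. (- 2) * (1 / (1 + x \<bullet> x) * ((x \<bullet> h) / (1 + x \<bullet> x)))"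
    have d: "((\<lambda>x. 1 / (1 + x \<bullet> x)) has_derivative ?D x) (at x)" for x :: 'a
    proof -
      have "1 + x \<bullet> x \<noteq> 0"
        by (metis add_pos_nonneg inner_ge_zero less_irrefl zero_less_one)
      then show ?thesis
        by (auto intro!: derivative_eq_intros simp: fun_eq_iff inner_commute field_simps)
    qed
    have e: "(\<lambda>x. ?D x h) \<in> cauchy_algebra" for h
      by (intro cauchy_algebra.add cauchy_algebra.mult cauchy_algebra.base cauchy_algebra.coord
          cauchy_algebra.const)
    show ?case
      by (rule exI[of _ ?D]) (intro conjI allI d e)
  next
    case (coord b)
    let ?D = "\<lambda>x h. (h \<bullet> b) * (1 / (1 + x \<bullet> x))
      + (- 2) * ((x \<bullet> b) / (1 + x \<bullet> x) * ((x \<bullet> h) / (1 + x \<bullet> x)))"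
    have d: "((\<lambda>x. (x \<bullet> b) / (1 + x \<bullet> x)) has_derivative ?D x) (at x)" for x :: 'a
    proof -
      have nz: "1 + x \<bullet> x \<noteq> 0"
        by (metis add_pos_nonneg inner_ge_zero less_irrefl zero_less_one)
      have num: "((\<lambda>x. x \<bullet> b) has_derivative (\<lambda>h. h \<bullet> b)) (at x)"
        by (auto intro!: derivative_eq_intros)
      have den: "((\<lambda>x. 1 + x \<bullet> x) has_derivative (\<lambda>h. 2 * (x \<bullet> h))) (at x)"
        by (auto intro!: derivative_eq_intros simp: inner_commute)
      have "(a * S - m * (2 * k)) / (S * S) = a * (1 / S) + (- 2) * (m / S * (k / S))"
        if "S \<noteq> 0" for a m k S :: real
        using that by (simp add: field_simps)
      then show ?thesis
        using has_derivative_divide'[OF num den nz] nz by simp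
    qed
    have e: "(\<lambda>x. ?D x h) \<in> cauchy_algebra" for h
      by (intro cauchy_algebra.add cauchy_algebra.mult cauchy_algebra.base cauchy_algebra.coord
          cauchy_algebra.const)
    show ?case
      by (rule exI[of _ ?D]) (intro conjI allI d e)
  next
    case (add f g)
    then obtain D E where D: "\<forall>x. (f has_derivative D x) (at x)" "\<forall>b. (\<lambda>x. D x b) \<in> cauchy_algebra"
      and E: "\<forall>x. (g has_derivative E x) (at x)" "\<forall>b. (\<lambda>x. E x b) \<in> cauchy_algebra" by blast
    show ?case
      by (rule exI[of _ "\<lambda>x h. D x h + E x h"])
        (intro conjI allI has_derivative_add cauchy_algebra.add D(1)[rule_format] D(2)[rule_format]
          E(1)[rule_format] E(2)[rule_format])
  next
    case (mult f g)
    then obtain D E where D: "\<forall>x. (f has_derivative D x) (at x)" "\<forall>b. (\<lambda>x. D x b) \<in> cauchy_algebra"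
      and E: "\<forall>x. (g has_derivative E x) (at x)" "\<forall>b. (\<lambda>x. E x b) \<in> cauchy_algebra" by blast
    show ?case
      by (rule exI[of _ "\<lambda>x h. f x * E x h + D x h * g x"])
        (intro conjI allI has_derivative_mult cauchy_algebra.add
          cauchy_algebra.mult[OF mult.hyps(1)] cauchy_algebra.mult[OF _ mult.hyps(2)]
          D(1)[rule_format] D(2)[rule_format] E(1)[rule_format] E(2)[rule_format])
  qed
  then show thesis using that by blast
qed

text \<open>By induction on the list of directions every iterated partial derivative stays in the
  algebra, hence is bounded and differentiable.\<close>

lemma cauchy_algebra_subset_Cb_infinity: "cauchy_algebra \<subseteq> Cb_infinity"
proof
  fix f :: "'a \<Rightarrow> real" assume f: "f \<in> cauchy_algebra"
  have "iter_partial f is \<in> cauchy_algebra" for "is"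
  proof (induction "is")
    case (Cons i "is")
    obtain D where D: "\<And>x. (iter_partial f is has_derivative D x) (at x)" "\<And>b. (\<lambda>x. D x b) \<in> cauchy_algebra"
      using cauchy_algebra_derivative[OF Cons] by blast
    have "iter_partial f (i # is) = (\<lambda>x. D x i)"
      using frechet_derivative_at[OF D(1)] by (simp add: fun_eq_iff)
    then show ?case using D(2) by simp
  qed (use f in simp)
  moreover have "g differentiable (at x)" if "g \<in> cauchy_algebra" for g :: "'a \<Rightarrow> real" and x
    using cauchy_algebra_derivative[OF that] by (metis differentiableI)
  ultimately show "f \<in> Cb_infinity"
    unfolding Cb_infinity_def using cauchy_algebra_bounded by blast
qed

section \<open>Powers of the Cauchy profile and their integrals\<close>

definition bump :: "nat \<Rightarrow> 'a::euclidean_space \<Rightarrow> real" where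
  "bump n x = (1 / (1 + x \<bullet> x)) ^ n"

lemma bump_Cb_infinity: "bump n \<in> Cb_infinity"
proof -
  have "(\<lambda>x. (1 / (1 + x \<bullet> x)) ^ n) \<in> (cauchy_algebra :: ('a \<Rightarrow> real) set)"
  proof (induction n)
    case 0
    show ?case by (simp add: cauchy_algebra.const)
  next
    case (Suc n)
    show ?case
      using cauchy_algebra.mult[OF cauchy_algebra.base Suc] by simp
  qed
  then show ?thesis
    using cauchy_algebra_subset_Cb_infinity by (auto simp: bump_def[abs_def])
qed

lemma bump_measurable [measurable]: "bump n \<in> borel_measurable borel"
  by (rule Cb_infinity_measurable[OF bump_Cb_infinity])

lemma bump_nonneg [simp]: "bump n x \<ge> 0"
  by (simp add: bump_def add_nonneg_nonneg)

lemma bump_le_1: "bump n x \<le> 1"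
  unfolding bump_def by (intro power_le_one) (auto simp: divide_le_eq_1 add_pos_nonneg)

lemma bump_sq: "(bump n x)\<^sup>2 = bump (2 * n) x"
  by (simp add: bump_def mult.commute flip: power_mult)

lemma bump_ge:
  assumes "norm x \<le> r"
  shows "(1 / (1 + r\<^sup>2)) ^ n \<le> bump n x"
  unfolding bump_def
proof (rule power_mono)
  have "x \<bullet> x \<le> r\<^sup>2"
    using assms by (simp add: power_mono flip: power2_norm_eq_inner)
  then show "1 / (1 + r\<^sup>2) \<le> 1 / (1 + x \<bullet> x)"
    by (intro divide_left_mono) (auto intro!: mult_pos_pos add_pos_nonneg)
qed (simp add: add_nonneg_nonneg)

text \<open>With \<open>m = max 1 (norm x)\<close>, both sides are compared with
  \<open>m powr p\<close>. This makes a sufficiently high power Lebesgue integrable.\<close>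

lemma bump_le_weight:
  assumes p: "p \<ge> 0" and n: "p \<le> 2 * real n"
  shows "bump n x \<le> 2 * (1 / (1 + norm x powr p))"
proof -
  define m where "m = max 1 (norm x)"
  have m: "m \<ge> 1" by (simp add: m_def)
  have "m\<^sup>2 \<le> 1 + x \<bullet> x"
    by (auto simp: m_def max_def simp flip: power2_norm_eq_inner)
  then have "(m\<^sup>2) ^ n \<le> (1 + x \<bullet> x) ^ n"
    by (rule power_mono) simp
  moreover have "m powr p \<le> (m\<^sup>2) ^ n"
  proof -
    have "m powr p \<le> m powr (2 * real n)" using m n by (intro powr_mono) auto
    also have "\<dots> = m ^ (2 * n)" using m powr_realpow[of m "2 * n"] by simp
    finally show ?thesis by (simp add: power_mult)
  qed
  moreover have "1 + norm x powr p \<le> 2 * m powr p"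
  proof -
    have "1 \<le> m powr p" using m p by (simp add: ge_one_powr_ge_zero)
    moreover have "norm x powr p \<le> m powr p" using p by (intro powr_mono2) (auto simp: m_def)
    ultimately show ?thesis by simp
  qed
  ultimately have "1 + norm x powr p \<le> 2 * (1 + x \<bullet> x) ^ n" by linarith
  moreover have "(1 + x \<bullet> x) ^ n > 0" by (intro zero_less_power) (simp add: add_pos_nonneg)
  moreover have "1 + norm x powr p > 0" by (simp add: add_pos_nonneg)
  ultimately show ?thesis
    by (simp add: bump_def power_one_over field_simps)
qed

text \<open>Outside the unit ball each of the \<open>n - m\<close> extra factors is at most
  \<open>1 / 2\<close>.\<close>

lemma bump_outside_ball:
  assumes "norm x \<ge> 1" "m \<le> n"
  shows "bump n x \<le> (1 / 2) ^ (n - m) * bump m x"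
proof -
  have "1 + x \<bullet> x \<ge> 2"
    using power_mono[OF assms(1), of 2] by (simp flip: power2_norm_eq_inner)
  then have "(1 / (1 + x \<bullet> x)) ^ (n - m) \<le> (1 / 2) ^ (n - m)"
    by (intro power_mono divide_left_mono) auto
  moreover have "bump n x = (1 / (1 + x \<bullet> x)) ^ (n - m) * bump m x"
    using assms(2) by (simp add: bump_def flip: power_add)
  ultimately show ?thesis
    by (simp add: mult_right_mono)
qed

text \<open>Only the ball of radius \<open>r\<close> is kept, where both the density and the
  function are bounded below. Small \<open>r\<close> brings the ratio close to 1, so the decay is
  slower than any exponential.\<close>

lemma bump_mu_ge:
  fixes V :: "'a::euclidean_space \<Rightarrow> real"
  assumes Vm[measurable]: "V \<in> borel_measurable borel"
    and V: "locally_bounded V" "integrable lborel (\<lambda>x. exp (- V x))" and r: "r > 0"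
  obtains k where "k > 0" "\<And>n. ennreal (k * (1 / (1 + r\<^sup>2)) ^ n) \<le> (\<integral>\<^sup>+x. ennreal (bump n x) \<partial>mu V)"
proof -
  obtain k where k: "k > 0" "\<And>x. norm x \<le> r \<Longrightarrow> k \<le> norm_const V * exp (- V x)"
    using mu_density_ge_on_cball[OF V] by blast
  let ?v = "unit_ball_vol (real DIM('a)) * r ^ DIM('a)"
  have v: "?v > 0" using r by simp
  have "ennreal (k * ?v * (1 / (1 + r\<^sup>2)) ^ n) \<le> (\<integral>\<^sup>+x. ennreal (bump n x) \<partial>mu V)" for n
  proof -
    let ?q = "(1 / (1 + r\<^sup>2)) ^ n"
    have q: "?q \<ge> 0" by (simp add: add_nonneg_nonneg)
    have "ennreal (k * ?v * ?q) = ennreal (k * ?q) * ennreal ?v"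
      using k v q by (subst ennreal_mult[symmetric]) (auto simp: ac_simps)
    also have "\<dots> = ennreal (k * ?q) * emeasure lborel (ball (0::'a) r)"
      using r by (simp add: emeasure_ball)
    also have "\<dots> = (\<integral>\<^sup>+x. ennreal (k * ?q) * indicator (ball (0::'a) r) x \<partial>lborel)"
      by (rule nn_integral_cmult_indicator[symmetric]) simp
    also have "\<dots> \<le> (\<integral>\<^sup>+x. ennreal (norm_const V * exp (- V x)) * ennreal (bump n x) \<partial>lborel)"
    proof (intro nn_integral_mono)
      fix x :: 'a
      have "k * ?q \<le> norm_const V * exp (- V x) * bump n x" if "norm x < r"
        using that k bump_ge[of x r n] q by (intro mult_mono) (auto intro: order_trans[OF less_imp_le])
      then show "ennreal (k * ?q) * indicator (ball (0::'a) r) x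
        \<le> ennreal (norm_const V * exp (- V x)) * ennreal (bump n x)"
        using norm_const_pos[OF V(2)] by (auto simp: indicator_def simp flip: ennreal_mult intro!: ennreal_leI)
    qed
    also have "\<dots> = (\<integral>\<^sup>+x. ennreal (bump n x) \<partial>mu V)"
      by (rule nn_integral_mu[symmetric]) measurable
    finally show ?thesis .
  qed
  then show thesis using k v by (intro that[of "k * ?v"]) auto
qed

text \<open>Inside the unit ball the density bound compares the two measures. Outside, the Lebesgue
  integral is of order \<open>2^(-n)\<close>, and \<open>bump_mu_ge\<close> with radius 1 shows that
  the \<open>mu V\<close>-integral is at least of that order.\<close>

lemma bump_lebesgue_le_mu:
  fixes V :: "'a::euclidean_space \<Rightarrow> real"
  assumes Vm[measurable]: "V \<in> borel_measurable borel"
    and V: "locally_bounded V" "integrable lborel (\<lambda>x. exp (- V x))"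
  obtains C m where "C > 0" "\<And>n. n \<ge> m \<Longrightarrow>
    (\<integral>\<^sup>+(x::'a). ennreal (bump n x) \<partial>lborel) \<le> ennreal C * (\<integral>\<^sup>+x. ennreal (bump n x) \<partial>mu V)"
proof -
  obtain k where k: "k > 0" "\<And>x. norm x \<le> 1 \<Longrightarrow> k \<le> norm_const V * exp (- V x)"
    using mu_density_ge_on_cball[OF V] by blast
  obtain l where l: "l > 0" "\<And>n. ennreal (l * (1 / (1 + 1\<^sup>2)) ^ n) \<le> (\<integral>\<^sup>+x. ennreal (bump n x) \<partial>mu V)"
    using bump_mu_ge[OF Vm V zero_less_one] by blast
  \<comment> \<open>An exponent above the dimension makes the weight, and hence
    \<open>bump m\<close>, integrable.\<close>
  define m where "m = Suc DIM('a)"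
  have "(\<integral>\<^sup>+(x::'a). ennreal (bump m x) \<partial>lborel)
    \<le> (\<integral>\<^sup>+(x::'a). 2 * ennreal (1 / (1 + norm x powr real m)) \<partial>lborel)"
    using bump_le_weight[of "real m" m]
    by (intro nn_integral_mono) (simp add: m_def ennreal_leI flip: ennreal_numeral ennreal_mult)
  also have "\<dots> < \<infinity>"
    using nn_integral_inverse_one_plus_norm_powr_finite[where 'a='a, of "real m"]
    by (simp add: nn_integral_cmult m_def ennreal_mult_less_top)
  finally obtain W where W: "W \<ge> 0" "(\<integral>\<^sup>+(x::'a). ennreal (bump m x) \<partial>lborel) = ennreal W"
    by (cases "\<integral>\<^sup>+(x::'a). ennreal (bump m x) \<partial>lborel") auto
  let ?C = "1 / k + 2 ^ m * W / l"
  have "(\<integral>\<^sup>+(x::'a). ennreal (bump n x) \<partial>lborel) \<le> ennreal ?C * (\<integral>\<^sup>+x. ennreal (bump n x) \<partial>mu V)"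
    if n: "n \<ge> m" for n
  proof -
    let ?\<mu> = "\<integral>\<^sup>+x. ennreal (bump n x) \<partial>mu V"
    have q: "(1 / 2 :: real) ^ (n - m) = 2 ^ m * (1 / 2) ^ n"
      using n by (simp add: power_diff power_one_over field_simps)
    have "(\<integral>\<^sup>+(x::'a). ennreal (bump n x) \<partial>lborel)
      \<le> (\<integral>\<^sup>+x. ennreal (1 / k) * (ennreal (norm_const V * exp (- V x)) * ennreal (bump n x))
          + ennreal ((1 / 2) ^ (n - m)) * ennreal (bump m x) \<partial>lborel)"
    proof (intro nn_integral_mono)
      fix x :: 'a
      have "bump n x \<le> 1 / k * (norm_const V * exp (- V x) * bump n x) + (1 / 2) ^ (n - m) * bump m x"
      proof (cases "norm x \<le> 1")
        case True
        have "k * bump n x \<le> norm_const V * exp (- V x) * bump n x"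
          using k(2)[OF True] by (intro mult_right_mono) auto
        then have "bump n x \<le> 1 / k * (norm_const V * exp (- V x) * bump n x)"
          using k(1) by (simp add: field_simps)
        then show ?thesis by (simp add: add_increasing2)
      next
        case False
        then show ?thesis
          using bump_outside_ball[of x m n] n k(1) norm_const_pos[OF V(2)] by (simp add: add_increasing)
      qed
      then show "ennreal (bump n x) \<le> ennreal (1 / k) * (ennreal (norm_const V * exp (- V x)) * ennreal (bump n x))
          + ennreal ((1 / 2) ^ (n - m)) * ennreal (bump m x)"
        using k(1) norm_const_pos[OF V(2)] by (simp add: ennreal_leI flip: ennreal_mult ennreal_plus)
    qed
    also have "\<dots> = ennreal (1 / k) * ?\<mu> + ennreal ((1 / 2) ^ (n - m)) * ennreal W"
      by (simp add: nn_integral_add nn_integral_cmult nn_integral_mu W)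
    also have "ennreal ((1 / 2) ^ (n - m)) * ennreal W = ennreal (2 ^ m * W / l) * ennreal (l * (1 / (1 + 1\<^sup>2)) ^ n)"
      using W(1) l(1) by (simp add: q flip: ennreal_mult)
    also have "\<dots> \<le> ennreal (2 ^ m * W / l) * ?\<mu>"
      by (intro mult_left_mono l) auto
    finally show ?thesis
      using k(1) l(1) W(1) by (simp add: ennreal_plus distrib_right add_left_mono)
  qed
  moreover have "?C > 0" using k(1) l(1) W(1) by (intro add_pos_nonneg) auto
  ultimately show thesis by (rule that[rotated])
qed

subsection \<open>Failure of the super Poincare inequality\<close>

lemma nn_integral_lborel_shift:
  fixes g :: "'a::euclidean_space \<Rightarrow> ennreal"
  assumes [measurable]: "g \<in> borel_measurable borel"
  shows "(\<integral>\<^sup>+y. g (y - x) \<partial>lborel) = (\<integral>\<^sup>+y. g y \<partial>lborel)"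
proof -
  have "(\<integral>\<^sup>+y. g y \<partial>lborel) = (\<integral>\<^sup>+y. g y \<partial>distr lborel borel ((+) (- x)))"
    by (simp add: lborel_distr_plus)
  also have "\<dots> = (\<integral>\<^sup>+y. g (- x + y) \<partial>lborel)"
    by (rule nn_integral_distr) measurable
  finally show ?thesis by simp
qed

text \<open>After expanding the square, the kernel is integrated in \<open>y\<close> for the term
  \<open>(f x)^2\<close>, and bounded by 1 for the term \<open>(f y)^2\<close>, where
  \<open>mu V\<close> has total mass 1. The constant \<open>K\<close> depends on neither
  \<open>V\<close> nor \<open>f\<close>.\<close>

lemma Dform_le:
  fixes \<alpha> :: real
  assumes \<alpha>: "\<alpha> > 0"
  obtains K where "K > 0" "\<And>V (f::'a::euclidean_space \<Rightarrow> real). V \<in> borel_measurable borel \<Longrightarrow>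
    integrable lborel (\<lambda>x. exp (- V x)) \<Longrightarrow> f \<in> borel_measurable borel \<Longrightarrow>
    Dform \<alpha> V f \<le> ennreal K * (\<integral>\<^sup>+x. ennreal ((f x)\<^sup>2) \<partial>mu V) + (\<integral>\<^sup>+x. ennreal ((f x)\<^sup>2) \<partial>lborel)"
proof -
  define p where "p = real DIM('a) + \<alpha>"
  let ?w = "\<lambda>x::'a. 1 / (1 + norm x powr p)"
  have p: "p > 0" "real DIM('a) < p" using \<alpha> by (auto simp: p_def add_pos_pos)
  have w0: "?w x \<ge> 0" for x by (simp add: add_nonneg_nonneg)
  obtain W where W: "W \<ge> 0" "(\<integral>\<^sup>+x. ennreal (?w x) \<partial>lborel) = ennreal W"
    using nn_integral_inverse_one_plus_norm_powr_finite[OF p(2)]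
    by (cases "\<integral>\<^sup>+x. ennreal (?w x) \<partial>lborel") auto
  have "Dform \<alpha> V f \<le> ennreal (2 * W + 1) * (\<integral>\<^sup>+x. ennreal ((f x)\<^sup>2) \<partial>mu V) + (\<integral>\<^sup>+x. ennreal ((f x)\<^sup>2) \<partial>lborel)"
    if [measurable]: "V \<in> borel_measurable borel" "f \<in> borel_measurable borel"
      and i: "integrable lborel (\<lambda>x. exp (- V x))" for V and f :: "'a \<Rightarrow> real"
  proof -
    let ?L = "\<integral>\<^sup>+x. ennreal ((f x)\<^sup>2) \<partial>lborel"
    have pointwise: "ennreal ((f x - f y)\<^sup>2 / norm (x - y) powr p) * indicator {y. norm (x - y) > 1} y
      \<le> ennreal (4 * (f x)\<^sup>2) * ennreal (?w (y - x)) + 2 * ennreal ((f y)\<^sup>2)" for x y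
    proof (cases "norm (x - y) > 1")
      case True
      define N where "N = norm (x - y) powr p"
      have N: "N \<ge> 1" using True p by (simp add: N_def ge_one_powr_ge_zero)
      have "(f x - f y)\<^sup>2 \<le> 2 * (f x)\<^sup>2 + 2 * (f y)\<^sup>2"
        using zero_le_power2[of "f x + f y"] by (simp add: power2_eq_square algebra_simps)
      then have "(f x - f y)\<^sup>2 / N \<le> (2 * (f x)\<^sup>2 + 2 * (f y)\<^sup>2) / N"
        using N by (intro divide_right_mono) auto
      also have "\<dots> = 2 * (f x)\<^sup>2 * (1 / N) + 2 * (f y)\<^sup>2 * (1 / N)"
        by (simp add: add_divide_distrib)
      \<comment> \<open>Since \<open>N >= 1\<close>, one has \<open>1 / N <= 2 / (1 + N)\<close> and
        \<open>1 / N <= 1\<close>.\<close>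
      also have "\<dots> \<le> 2 * (f x)\<^sup>2 * (2 * (1 / (1 + N))) + 2 * (f y)\<^sup>2 * 1"
        using N by (intro add_mono mult_left_mono) (auto simp: field_simps)
      finally have "(f x - f y)\<^sup>2 / N \<le> 4 * (f x)\<^sup>2 * (1 / (1 + N)) + 2 * (f y)\<^sup>2"
        by simp
      then have "ennreal ((f x - f y)\<^sup>2 / N) \<le> ennreal (4 * (f x)\<^sup>2 * (1 / (1 + N)) + 2 * (f y)\<^sup>2)"
        by (rule ennreal_leI)
      also have "\<dots> = ennreal (4 * (f x)\<^sup>2) * ennreal (1 / (1 + N)) + 2 * ennreal ((f y)\<^sup>2)"
      proof -
        have "4 * (f x)\<^sup>2 * (1 / (1 + N)) \<ge> 0" "2 * (f y)\<^sup>2 \<ge> 0" using N by auto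
        moreover have "ennreal (4 * (f x)\<^sup>2 * (1 / (1 + N))) = ennreal (4 * (f x)\<^sup>2) * ennreal (1 / (1 + N))"
          using N by (intro ennreal_mult) auto
        moreover have "ennreal (2 * (f y)\<^sup>2) = 2 * ennreal ((f y)\<^sup>2)"
          by (simp add: ennreal_mult)
        ultimately show ?thesis by (simp only: ennreal_plus)
      qed
      finally show ?thesis using True by (simp add: N_def norm_minus_commute)
    qed simp
    have inner: "(\<integral>\<^sup>+y\<in>{y. norm (x - y) > 1}. ennreal ((f x - f y)\<^sup>2 / norm (x - y) powr p) \<partial>lborel)
      \<le> ennreal (4 * W) * ennreal ((f x)\<^sup>2) + 2 * ?L" for x
    proof -
      have "(\<integral>\<^sup>+y\<in>{y. norm (x - y) > 1}. ennreal ((f x - f y)\<^sup>2 / norm (x - y) powr p) \<partial>lborel)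
        \<le> (\<integral>\<^sup>+y. ennreal (4 * (f x)\<^sup>2) * ennreal (?w (y - x)) + 2 * ennreal ((f y)\<^sup>2) \<partial>lborel)"
        by (intro nn_integral_mono pointwise)
      also have "\<dots> = ennreal (4 * (f x)\<^sup>2) * (\<integral>\<^sup>+y. ennreal (?w (y - x)) \<partial>lborel) + 2 * ?L"
        by (simp add: nn_integral_add nn_integral_cmult)
      also have "(\<integral>\<^sup>+y. ennreal (?w (y - x)) \<partial>lborel) = ennreal W"
        using nn_integral_lborel_shift[of "\<lambda>y. ennreal (?w y)" x] W(2) by simp
      also have "ennreal (4 * (f x)\<^sup>2) * ennreal W = ennreal (4 * W) * ennreal ((f x)\<^sup>2)"
        using W(1) by (simp add: ac_simps flip: ennreal_mult)
      finally show ?thesis .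
    qed
    have "Dform \<alpha> V f \<le> ennreal (1 / 2) * (\<integral>\<^sup>+x. ennreal (4 * W) * ennreal ((f x)\<^sup>2) + 2 * ?L \<partial>mu V)"
      unfolding Dform_def p_def[symmetric] by (intro mult_left_mono nn_integral_mono inner) auto
    also have "\<dots> = ennreal (1 / 2) * (ennreal (4 * W) * (\<integral>\<^sup>+x. ennreal ((f x)\<^sup>2) \<partial>mu V) + 2 * ?L)"
      by (simp add: nn_integral_add nn_integral_cmult emeasure_mu_UNIV i)
    also have "\<dots> = ennreal (2 * W) * (\<integral>\<^sup>+x. ennreal ((f x)\<^sup>2) \<partial>mu V) + ?L"
    proof -
      have "ennreal (1 / 2) * ennreal (4 * W) = ennreal (2 * W)"
        using W(1) by (subst ennreal_mult[symmetric]) auto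
      moreover have "ennreal (1 / 2) * 2 = 1"
        using ennreal_mult[of "1 / 2" 2] by simp
      ultimately show ?thesis
        by (simp only: distrib_left mult_1_left flip: mult.assoc)
    qed
    also have "\<dots> \<le> ennreal (2 * W + 1) * (\<integral>\<^sup>+x. ennreal ((f x)\<^sup>2) \<partial>mu V) + ?L"
      by (intro add_right_mono mult_right_mono ennreal_leI) auto
    finally show ?thesis .
  qed
  \<comment> \<open>The added 1 makes the constant positive from \<open>W >= 0\<close>
    alone.\<close>
  then show thesis using W(1) by (intro that[of "2 * W + 1"]) auto
qed

text \<open>Once \<open>B * a n\<close> is below \<open>1 / 4\<close>, repeated squaring forces
  \<open>B * a (n * 2^j) <= 4^(-2^j)\<close>. The lower bound with ratio \<open>2^(-1/n)\<close>
  gives \<open>a (n * 2^j) >= k * 2^(-2^j)\<close>, so \<open>B * k <= 2^(-2^j)\<close> for every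
  \<open>j\<close>.\<close>

lemma quadratic_decay_contradiction:
  fixes a :: "nat \<Rightarrow> real"
  assumes lim: "a \<longlonglongrightarrow> 0" and B: "B > 0"
    and quad: "\<And>n. n \<ge> m \<Longrightarrow> a (2 * n) \<le> B * (a n)\<^sup>2"
    and low: "\<And>q. 0 < q \<Longrightarrow> q < 1 \<Longrightarrow> \<exists>k>0. \<forall>n. k * q ^ n \<le> a n"
  shows False
proof -
  have pos: "a n \<ge> 0" for n
  proof -
    obtain k where "k > 0" "k * (1 / 2) ^ n \<le> a n" using low[of "1 / 2"] by auto
    then show ?thesis by (meson less_imp_le mult_pos_pos order_trans zero_less_power half_gt_zero zero_less_one)
  qed
  have "(\<lambda>n. B * a n) \<longlonglongrightarrow> 0" using tendsto_mult_right_zero[OF lim, of B] by (simp add: mult.commute)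
  then have "\<forall>\<^sub>F n in sequentially. B * a n < 1 / 4"
    by (rule order_tendstoD) simp
  then obtain N where "\<forall>n\<ge>N. B * a n < 1 / 4" unfolding eventually_sequentially by blast
  then obtain n where n: "n \<ge> m" "n \<ge> 1" "B * a n < 1 / 4"
    by (metis max.cobounded1 max.cobounded2 max.coboundedI1 max.coboundedI2)
  have upper: "B * a (n * 2 ^ j) \<le> (1 / 4) ^ (2 ^ j)" for j
  proof (induction j)
    case 0
    show ?case using n(3) by simp
  next
    case (Suc j)
    have "n \<le> n * 2 ^ j" by simp
    then have "a (2 * (n * 2 ^ j)) \<le> B * (a (n * 2 ^ j))\<^sup>2"
      using n(1) by (intro quad) linarith
    then have "B * a (n * 2 ^ Suc j) \<le> (B * a (n * 2 ^ j))\<^sup>2"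
      using mult_left_mono[of _ _ B] B by (simp add: power2_eq_square ac_simps)
    also have "\<dots> \<le> ((1 / 4) ^ (2 ^ j))\<^sup>2"
      using Suc pos B by (intro power_mono) auto
    also have "\<dots> = (1 / 4) ^ (2 ^ Suc j)"
      by (simp add: mult.commute flip: power_mult)
    finally show ?case .
  qed
  \<comment> \<open>The ratio is chosen after \<open>n\<close> is fixed, which is why the lower
    bound is assumed for every \<open>q\<close> below 1.\<close>
  define q where "q = root n (1 / 2)"
  have q: "0 < q" "q < 1" "q ^ n = 1 / 2"
    using n(2) by (auto simp: q_def real_root_lt_1_iff)
  obtain k where k: "k > 0" "\<And>n. k * q ^ n \<le> a n" using low[OF q(1,2)] by blast
  have "B * k \<le> (1 / 2) ^ (2 ^ j)" for j
  proof -
    have "B * (k * (1 / 2) ^ (2 ^ j)) \<le> B * a (n * 2 ^ j)"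
      using k(2)[of "n * 2 ^ j"] B q(3) by (intro mult_left_mono) (auto simp: power_mult)
    also have "\<dots> \<le> (1 / 4) ^ (2 ^ j)" by (rule upper)
    also have "\<dots> = (1 / 2) ^ (2 ^ j) * (1 / 2) ^ (2 ^ j)"
      by (simp flip: power_mult_distrib)
    finally have "B * k * (1 / 2) ^ (2 ^ j) \<le> (1 / 2) ^ (2 ^ j) * (1 / 2) ^ (2 ^ j)"
      by (simp add: mult.assoc)
    then show ?thesis by (rule mult_right_le_imp_le) simp
  qed
  moreover have "(1 / 2 :: real) ^ (2 ^ j) \<le> (1 / 2) ^ j" for j :: nat
    by (intro power_decreasing) (auto simp: less_imp_le)
  ultimately have "B * k \<le> (1 / 2) ^ j" for j :: nat
    using order_trans by blast
  moreover obtain j where "(1 / 2) ^ j < B * k"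
    using real_arch_pow_inv[of "B * k" "1 / 2"] B k(1) by auto
  ultimately show False by (meson not_le)
qed

lemma bump_mu_tendsto_0:
  fixes V :: "'a::euclidean_space \<Rightarrow> real"
  assumes Vm[measurable]: "V \<in> borel_measurable borel" and i: "integrable lborel (\<lambda>x. exp (- V x))"
  shows "(\<lambda>n. \<integral>x. bump n x \<partial>mu V) \<longlonglongrightarrow> 0"
proof -
  have "(\<lambda>n. \<integral>x. bump n x \<partial>mu V) \<longlonglongrightarrow> (\<integral>x. 0 \<partial>mu V)"
  proof (rule integral_dominated_convergence[where w = "\<lambda>_. 1"])
    show "integrable (mu V) (\<lambda>_. 1 :: real)"
      by (rule integrable_mu_bounded[OF Vm i, of _ 1]) auto
    \<comment> \<open>At the origin every \<open>bump n\<close> equals 1; this single point is null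
      for Lebesgue measure, hence for \<open>mu V\<close>.\<close>
    have "AE x::'a in lborel. x \<noteq> 0"
      by (rule AE_lborel_singleton)
    then have "AE x in mu V. x \<noteq> 0"
      unfolding mu_def by (subst AE_density) auto
    then show "AE x in mu V. (\<lambda>n. bump n x) \<longlonglongrightarrow> 0"
    proof eventually_elim
      case (elim x)
      then have "x \<bullet> x > 0" by simp
      then show ?case
        unfolding bump_def by (intro LIMSEQ_power_zero) (simp add: divide_less_eq_1 add_pos_nonneg)
    qed
    show "AE x in mu V. norm (bump n x) \<le> 1" for n
      by (simp add: bump_le_1)
  qed simp_all
  then show ?thesis by simp
qed

lemma no_super_poincare:
  fixes V :: "'a::euclidean_space \<Rightarrow> real"
  assumes \<alpha>: "\<alpha> > 0" and Vm[measurable]: "V \<in> borel_measurable borel"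
    and V: "locally_bounded V" "integrable lborel (\<lambda>x. exp (- V x))"
    and \<beta>: "\<And>s. s > 0 \<Longrightarrow> \<beta> s > 0"
    and sp: "\<And>s f. s > 0 \<Longrightarrow> f \<in> Cb_infinity \<Longrightarrow> (\<integral>\<^sup>+x. ennreal ((f x)\<^sup>2) \<partial>mu V)
      \<le> ennreal s * Dform \<alpha> V f + ennreal (\<beta> s) * (\<integral>\<^sup>+x. ennreal \<bar>f x\<bar> \<partial>mu V)\<^sup>2"
  shows False
proof -
  obtain K where K: "K > 0" "\<And>f. f \<in> borel_measurable borel \<Longrightarrow>
    Dform \<alpha> V f \<le> ennreal K * (\<integral>\<^sup>+x. ennreal ((f x)\<^sup>2) \<partial>mu V) + (\<integral>\<^sup>+x. ennreal ((f x)\<^sup>2) \<partial>lborel)"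
    using Dform_le[where 'a='a, OF \<alpha>] Vm V(2) by metis
  obtain C m where C: "C > 0" "\<And>n. n \<ge> m \<Longrightarrow>
    (\<integral>\<^sup>+(x::'a). ennreal (bump n x) \<partial>lborel) \<le> ennreal C * (\<integral>\<^sup>+x. ennreal (bump n x) \<partial>mu V)"
    using bump_lebesgue_le_mu[OF Vm V] by metis
  define a where "a n = (\<integral>x. bump n x \<partial>mu V)" for n
  have a0: "a n \<ge> 0" for n by (simp add: a_def)
  have nn: "(\<integral>\<^sup>+x. ennreal (bump n x) \<partial>mu V) = ennreal (a n)" for n
    unfolding a_def
    by (intro nn_integral_eq_integral integrable_mu_bounded[OF Vm V(2), of _ 1])
      (auto simp: bump_le_1)
  \<comment> \<open>With this choice the energy term is at most half of \<open>a (2 * n)\<close> and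
    is absorbed on the left, doubling \<open>\<beta> s\<close>.\<close>
  define s where "s = 1 / (2 * (K + C))"
  have s: "s > 0" using K C by (simp add: s_def)
  show False
  proof (rule quadratic_decay_contradiction)
    show "a \<longlonglongrightarrow> 0"
      unfolding a_def by (rule bump_mu_tendsto_0[OF Vm V(2)])
    show "2 * \<beta> s > 0" using \<beta>[OF s] by simp
    show "a (2 * n) \<le> 2 * \<beta> s * (a n)\<^sup>2" if "n \<ge> m" for n
    proof -
      have "Dform \<alpha> V (bump n) \<le> ennreal K * ennreal (a (2 * n)) + (\<integral>\<^sup>+(x::'a). ennreal (bump (2 * n) x) \<partial>lborel)"
        using K(2)[of "bump n"] by (simp add: bump_sq nn)
      also have "\<dots> \<le> ennreal K * ennreal (a (2 * n)) + ennreal C * ennreal (a (2 * n))"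
        using C(2)[of "2 * n"] that by (simp add: nn)
      also have "\<dots> = ennreal ((K + C) * a (2 * n))"
        using K(1) C(1) a0 by (simp add: ennreal_mult ennreal_plus distrib_right)
      finally have D: "Dform \<alpha> V (bump n) \<le> ennreal ((K + C) * a (2 * n))" .
      have "ennreal (a (2 * n)) \<le> ennreal s * Dform \<alpha> V (bump n) + ennreal (\<beta> s) * (ennreal (a n))\<^sup>2"
        using sp[OF s bump_Cb_infinity[of n]] by (simp add: bump_sq nn)
      also have "\<dots> \<le> ennreal s * ennreal ((K + C) * a (2 * n)) + ennreal (\<beta> s) * (ennreal (a n))\<^sup>2"
        by (intro add_right_mono mult_left_mono D) auto
      also have "\<dots> = ennreal (s * ((K + C) * a (2 * n)) + \<beta> s * (a n)\<^sup>2)"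
        using s \<beta>[OF s] K(1) C(1) a0 by (simp add: ennreal_mult ennreal_plus ennreal_power)
      finally have "a (2 * n) \<le> s * ((K + C) * a (2 * n)) + \<beta> s * (a n)\<^sup>2"
        using s \<beta>[OF s] K(1) C(1) a0 by (subst (asm) ennreal_le_iff) auto
      moreover have "s * ((K + C) * a (2 * n)) = a (2 * n) / 2"
      proof -
        have "s * (K + C) = 1 / 2" using K(1) C(1) by (simp add: s_def field_simps)
        then have "s * (K + C) * a (2 * n) = 1 / 2 * a (2 * n)" by (rule arg_cong)
        then show ?thesis by (simp only: mult.assoc)
      qed
      ultimately show ?thesis by simp
    qed
    fix q :: real assume q: "0 < q" "q < 1"
    \<comment> \<open>The radius for which the ratio in \<open>bump_mu_ge\<close> equals the
      prescribed \<open>q\<close>.\<close>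
    define r where "r = sqrt (1 / q - 1)"
    have "r > 0" "1 / (1 + r\<^sup>2) = q" using q by (auto simp: r_def)
    then obtain k where k: "k > 0" "\<And>n. ennreal (k * q ^ n) \<le> ennreal (a n)"
      using bump_mu_ge[OF Vm V, of r] unfolding nn by metis
    have "k * q ^ n \<le> a n" for n
      using k(2)[of n] a0 by simp
    then show "\<exists>k>0. \<forall>n. k * q ^ n \<le> a n" using k(1) by blast
  qed
qed

theorem theorem1p4:
  fixes V :: "'a::euclidean_space \<Rightarrow> real" and \<alpha> :: real
  assumes "0 < \<alpha>" and "\<alpha> < 2"
    and "V \<in> borel_measurable borel"
    and "locally_bounded V"
    and "integrable lborel (\<lambda>x. exp (- V x))"
  shows "(Liminf at_infinity
            (\<lambda>x. ereal (exp (V x) / norm x powr (real DIM('a) + \<alpha>))) > 0 \<longrightarrow>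
          (\<exists>C1::real. C1 > 0 \<and>
             (\<forall>f \<in> Cb_infinity. (\<integral>x. f x \<partial>mu V) = 0 \<longrightarrow>
                (\<integral>\<^sup>+ x. ennreal ((f x)\<^sup>2 * (exp (V x) / (1 + norm x powr (real DIM('a) + \<alpha>)))) \<partial>mu V)
                  \<le> ennreal C1 * Dform \<alpha> V f)) \<and>
          (\<exists>C2::real. C2 > 0 \<and>
             (\<forall>f \<in> Cb_infinity. (\<integral>x. f x \<partial>mu V) = 0 \<longrightarrow>
                (\<integral>\<^sup>+ x. ennreal ((f x)\<^sup>2) \<partial>mu V) \<le> ennreal C2 * Dform \<alpha> V f)))
       \<and>
         (\<not> (\<exists>\<beta> :: real \<Rightarrow> real. (\<forall>s>0. \<beta> s > 0) \<and>
             (\<forall>s>0. \<forall>f \<in> Cb_infinity.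
                (\<integral>\<^sup>+ x. ennreal ((f x)\<^sup>2) \<partial>mu V)
                  \<le> ennreal s * Dform \<alpha> V f
                    + ennreal (\<beta> s) * (\<integral>\<^sup>+ x. ennreal \<bar>f x\<bar> \<partial>mu V)\<^sup>2)))"
    (is "(?L \<longrightarrow> ?W \<and> ?P) \<and> ?S")
proof (intro conjI impI)
  let ?wt = "\<lambda>x::'a. 1 + norm x powr (real DIM('a) + \<alpha>)"
  assume L: ?L
  obtain C where C: "C > 0" "\<And>f. f \<in> Cb_infinity \<Longrightarrow> (\<integral>x. f x \<partial>mu V) = 0 \<Longrightarrow>
    (\<integral>\<^sup>+x. ennreal ((f x)\<^sup>2 * (exp (V x) / ?wt x)) \<partial>mu V) \<le> ennreal C * Dform \<alpha> V f"
    using weighted_poincare[OF assms(1,3-5) L] by blast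
  then show ?W by blast
  have "real DIM('a) + \<alpha> > 0" using assms(1) by (simp add: add_pos_pos)
  from mu_sq_le_weighted[OF assms(3,4) this L]
  obtain c where c: "c > 0" "\<And>f. f \<in> borel_measurable borel \<Longrightarrow>
    (\<integral>\<^sup>+x. ennreal ((f x)\<^sup>2) \<partial>mu V) \<le> ennreal c * (\<integral>\<^sup>+x. ennreal ((f x)\<^sup>2 * (exp (V x) / ?wt x)) \<partial>mu V)"
    by blast
  have "(\<integral>\<^sup>+x. ennreal ((f x)\<^sup>2) \<partial>mu V) \<le> ennreal (c * C) * Dform \<alpha> V f"
    if f: "f \<in> Cb_infinity" "(\<integral>x. f x \<partial>mu V) = 0" for f
  proof -
    note c(2)[OF Cb_infinity_measurable[OF f(1)]]
    also have "ennreal c * (\<integral>\<^sup>+x. ennreal ((f x)\<^sup>2 * (exp (V x) / ?wt x)) \<partial>mu V)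
        \<le> ennreal c * (ennreal C * Dform \<alpha> V f)"
      by (intro mult_left_mono C f) simp
    also have "\<dots> = ennreal (c * C) * Dform \<alpha> V f"
      using c(1) C(1) by (simp add: ennreal_mult mult.assoc)
    finally show ?thesis .
  qed
  then show ?P using c(1) C(1) by (intro exI[of _ "c * C"]) auto
next
  show ?S
    using no_super_poincare[OF assms(1,3-5)] by blast
qed

end
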